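(* Let $T$ be the infinite tree all of whose nodes have (countably) infinite degree. For every universal treasure hunt algorithm $\mathcal{A}$ executed on $T$, there exist instances $(b,t)$ of the treasure hunt problem in $T$ of arbitrarily large weight (i.e., for every $K$ there is such an instance with $w(b,t)\ge K$) such that the time required by $\mathcal{A}$ to find the treasure for the instance $(b,t)$ is at least $w(b,t)/4$.
   Context: Graphs. A graph is undirected, possibly infinite, with every node of finite or countably infinite degree; self-loops and multiple edges are allowed. Ports at a node of finite degree $d$ are arbitrarily numbered $1,\dots,d$; ports at a node of infinite degree are arbitrarily numbered by all distinct positive integers. Nodes are anonymous and cannot be marked. Treasure hunt. An instance in a graph $G$ is an ordered pair $(b,t)$ of nodes: $b$ (the base) is the starting node of the agent and $t$ is the unknown node containing the treasure. The agent is deterministic, has unbounded memory and no a priori knowledge. In each step it chooses a port at the current node and traverses the corresponding edge; on entering a node it learns the port number by which it entered. It gets no information about the location of the treasure before visiting $t$. The time for the instance $(b,t)$ is the number of edge traversals performed until the agent visits $t$. A universal treasure hunt algorithm is a deterministic algorithm that solves the treasure hunt problem (finds the treasure in finite time) for every instance on every connected graph. Weight. A path from $u$ to $v$ is a finite sequence $\pi=(p_1,\dots,p_\delta)$ of port numbers such that taking port $p_1$ at $u$ and then ports $p_2,\dots,p_\delta$ at the subsequently visited nodes leads to $v$ (nodes may repeat). Its type is $(m,\delta)$ with $m=\max(p_1,\dots,p_\delta)$, and the value of a pair $(x,y)$ is $y\,2^y x^y$. The weight $w(u,v)$ is the smallest value of the type of any path from $u$ to $v$. *)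

theory Defs
  imports Complex_Main "HOL-Library.Extended_Nat" "Graph_Theory.Graph_Theory"
begin

section \<open>Port-numbered graphs\<close>

text \<open>
  An undirected multigraph is a digraph with a fixed-point-free involution \<open>arev\<close> on its arcs: the
  edges are the pairs \<open>{a, arev a}\<close>. An arc is one end of an edge, seen from its tail; a self-loop
  has two ends at its node, hence contributes two to the degree and has two ports.
\<close>

definition node_degree :: "('a, 'b) pre_digraph \<Rightarrow> 'a \<Rightarrow> enat" where
  "node_degree G v = (if finite (out_arcs G v) then enat (out_degree G v) else \<infinity>)"

definition ports_of :: "('a, 'b) pre_digraph \<Rightarrow> 'a \<Rightarrow> nat set" where
  "ports_of G v = {p. 1 \<le> p \<and> enat p \<le> node_degree G v}"

text \<open>
  The port numbering forces every degree to be finite or countably infinite.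
\<close>

locale port_graph = bidirected_digraph G arev
  for G :: "('a, 'b) pre_digraph" and arev :: "'b \<Rightarrow> 'b" +
  fixes port :: "'b \<Rightarrow> nat"
  assumes port_bij: "v \<in> verts G \<Longrightarrow> bij_betw port (out_arcs G v) (ports_of G v)"

definition arc_at :: "('a, 'b) pre_digraph \<Rightarrow> ('b \<Rightarrow> nat) \<Rightarrow> 'a \<Rightarrow> nat \<Rightarrow> 'b" where
  "arc_at G port v p = (THE a. a \<in> out_arcs G v \<and> port a = p)"

text \<open>
  The library predicate \<^const>\<open>tree\<close> counts the closed walk \<open>[a, arev a]\<close> as a cycle, so that no
  symmetric digraph with an arc satisfies it. A cycle of the undirected multigraph is a directed
  cycle that does not use any edge in both directions; self-loops and pairs of parallel edges are
  cycles in this sense.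
\<close>

definition undirected_tree :: "('a, 'b) pre_digraph \<Rightarrow> ('b \<Rightarrow> 'b) \<Rightarrow> bool" where
  "undirected_tree G arev \<longleftrightarrow>
     connected G \<and> \<not> (\<exists>p. pre_digraph.cycle G p \<and> (\<forall>a\<in>set p. arev a \<notin> set p))"


section \<open>Weight\<close>

definition port_path ::
  "('a, 'b) pre_digraph \<Rightarrow> ('b \<Rightarrow> nat) \<Rightarrow> 'a \<Rightarrow> nat list \<Rightarrow> 'a \<Rightarrow> bool" where
  "port_path G port u ps v \<longleftrightarrow> (\<exists>p. pre_digraph.awalk G u p v \<and> map port p = ps)"

definition path_type :: "nat list \<Rightarrow> nat \<times> nat" where
  "path_type ps = (Max (set ps), length ps)"

fun type_value :: "nat \<times> nat \<Rightarrow> nat" where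
  "type_value (x, y) = y * 2 ^ y * x ^ y"

text \<open>
  The empty path from a node to itself is admitted. Its maximal port is unspecified, but its value
  is \<open>0\<close> in any case, because its length is \<open>0\<close>.
\<close>

definition weight :: "('a, 'b) pre_digraph \<Rightarrow> ('b \<Rightarrow> nat) \<Rightarrow> 'a \<Rightarrow> 'a \<Rightarrow> nat" where
  "weight G port u v = (LEAST k. \<exists>ps. port_path G port u ps v \<and> k = type_value (path_type ps))"


section \<open>Treasure hunt\<close>

text \<open>
  On entering a node the agent observes its entry port (\<open>None\<close> at the start) and the degree of the
  node. The degree is what allows the agent to choose among the existing ports. A deterministic
  agent with unbounded memory is a function from the list of all observations, the latest one
  last, to the next port; its own earlier choices are determined by this list.
\<close>

type_synonym observation = "nat option \<times> enat"

type_synonym algorithm = "observation list \<Rightarrow> nat"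

text \<open>
  The execution after \<open>n\<close> edge traversals: current node and observations so far. It is undefined
  (\<open>None\<close>) if the agent has chosen a port that does not exist.
\<close>

primrec execution :: "algorithm \<Rightarrow> ('a, 'b) pre_digraph \<Rightarrow> ('b \<Rightarrow> 'b) \<Rightarrow> ('b \<Rightarrow> nat) \<Rightarrow> 'a \<Rightarrow> nat
    \<Rightarrow> ('a \<times> observation list) option" where
  "execution A G arev port b 0 = Some (b, [(None, node_degree G b)])"
| "execution A G arev port b (Suc n) =
     (case execution A G arev port b n of
        None \<Rightarrow> None
      | Some (u, obs) \<Rightarrow>
          (if A obs \<in> ports_of G u
           then let a = arc_at G port u (A obs); v = head G a
                in Some (v, obs @ [(Some (port (arev a)), node_degree G v)])
           else None))"

definition at_node :: "algorithm \<Rightarrow> ('a, 'b) pre_digraph \<Rightarrow> ('b \<Rightarrow> 'b) \<Rightarrow> ('b \<Rightarrow> nat) \<Rightarrow> 'a \<Rightarrow> nat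
    \<Rightarrow> 'a \<Rightarrow> bool" where
  "at_node A G arev port b n t \<longleftrightarrow> map_option fst (execution A G arev port b n) = Some t"

definition hunt_time :: "algorithm \<Rightarrow> ('a, 'b) pre_digraph \<Rightarrow> ('b \<Rightarrow> 'b) \<Rightarrow> ('b \<Rightarrow> nat) \<Rightarrow> 'a \<Rightarrow> 'a
    \<Rightarrow> nat" where
  "hunt_time A G arev port b t = (LEAST n. at_node A G arev port b n t)"

text \<open>
  A connected graph with countable degrees has countably many nodes and arcs, so up to isomorphism
  the graphs whose nodes and arcs are natural numbers are all connected graphs.
\<close>

definition universal :: "algorithm \<Rightarrow> bool" where
  "universal A \<longleftrightarrow>
     (\<forall>(G :: (nat, nat) pre_digraph) arev port.
        port_graph G arev port \<and> connected G \<longrightarrow>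
        (\<forall>b\<in>verts G. \<forall>t\<in>verts G. \<exists>n. at_node A G arev port b n t))"

end

theory Submission
  imports Defs
begin

text \<open>
  Neighbours of the base suffice: the neighbour behind port \<open>p\<close> has weight at most \<open>2 p\<close>, while only
  finitely many nodes, say \<open>C\<close>, have weight below \<open>K\<close>. Among the \<open>m = 2 C + 2\<close> distinct neighbours
  behind the ports \<open>1, \<dots>, m\<close> at least \<open>m - C\<close> have weight at least \<open>K\<close>, and since the agent is at
  one node at a time, some of these is reached no earlier than at time \<open>m - C - 1 = m / 2\<close>.
\<close>

text \<open>Injectivity of \<open>port\<close> on arcs with a common tail forces two walks with the
  same start and the same ports to agree arc by arc.\<close>

lemma cas_det:
  assumes "pre_digraph.cas G u p v" "pre_digraph.cas G u q w"
    and "map port p = map port q" "set p \<subseteq> arcs G" "set q \<subseteq> arcs G"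
    and inj: "\<And>a c. a \<in> arcs G \<Longrightarrow> c \<in> arcs G \<Longrightarrow> tail G a = tail G c \<Longrightarrow> port a = port c \<Longrightarrow> a = c"
  shows "v = w"
  using assms(1-5)
proof (induction p arbitrary: u q)
  case Nil
  then show ?case by (simp add: pre_digraph.cas.simps)
next
  case (Cons a p)
  then obtain c q' where q: "q = c # q'" by (cases q) auto
  have "a = c"
    using Cons.prems inj by (auto simp: q pre_digraph.cas.simps)
  with Cons.IH[of "head G a" q'] Cons.prems show ?case
    by (auto simp: q pre_digraph.cas.simps)
qed

text \<open>The hypothesis ensures that each \<open>LEAST\<close> is attained;
  \<open>execution\<close> yields only one node per time, so equal times mean equal nodes.\<close>

lemma hunt_time_inj_on:
  assumes "\<And>t. t \<in> S \<Longrightarrow> \<exists>n. at_node A G arev port b n t"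
  shows "inj_on (hunt_time A G arev port b) S"
proof -
  have "at_node A G arev port b (hunt_time A G arev port b t) t" if "t \<in> S" for t
    unfolding hunt_time_def using assms[OF that] by (rule LeastI_ex)
  then show ?thesis
    unfolding inj_on_def at_node_def by (metis option.inject)
qed

lemma inj_on_nat_large_value:
  fixes f :: "'a \<Rightarrow> nat"
  assumes "inj_on f S" "N < card S"
  shows "\<exists>s\<in>S. N \<le> f s"
proof (rule ccontr)
  assume "\<not> ?thesis"
  then have "f ` S \<subseteq> {..<N}" by auto
  then have "card S \<le> N"
    using card_inj_on_le[OF assms(1), of "{..<N}"] by simp
  with assms(2) show False by simp
qed

context port_graph
begin

lemma port_inj:
  assumes "a \<in> arcs G" "c \<in> arcs G" "tail G a = tail G c" "port a = port c"
  shows "a = c"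
proof -
  have "inj_on port (out_arcs G (tail G c))"
    using port_bij[of "tail G c"] assms(2) by (simp add: bij_betw_def)
  then show ?thesis
    using assms by (auto simp: inj_on_def)
qed

lemma port_ge_1: "a \<in> arcs G \<Longrightarrow> 1 \<le> port a"
  using bij_betw_apply[OF port_bij[of "tail G a"], of a] by (simp add: ports_of_def)

lemma port_path_det:
  assumes "port_path G port u ps v" "port_path G port u ps w"
  shows "v = w"
proof -
  obtain p q where "awalk u p v" "awalk u q w" "map port p = map port q"
    using assms by (auto simp: port_path_def)
  then show ?thesis
    using cas_det[of G u p v q w port] port_inj by (simp add: awalk_def)
qed

lemma weight_attained:
  assumes "port_path G port u ps v"
  obtains qs where "port_path G port u qs v" "weight G port u v = type_value (path_type qs)"
proof -
  have "\<exists>qs. port_path G port u qs v \<and> weight G port u v = type_value (path_type qs)"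
    unfolding weight_def by (rule LeastI_ex) (use assms in blast)
  with that show thesis by blast
qed

lemma weight_le: "port_path G port u ps v \<Longrightarrow> weight G port u v \<le> type_value (path_type ps)"
  unfolding weight_def by (rule Least_le) blast

text \<open>Ports are at least 1, so for a nonempty path the length and the maximal port are each at
  most the value. The empty path, with its unspecified \<open>Max\<close>, satisfies both bounds
  trivially.\<close>

lemma port_path_bounds:
  assumes "port_path G port u ps v" and "type_value (path_type ps) < K"
  shows "set ps \<subseteq> {..K}" "length ps \<le> K"
proof -
  have "set ps \<subseteq> {..K} \<and> length ps \<le> K"
  proof (cases "ps = []")
    case False
    define x y where "x = Max (set ps)" and "y = length ps"
    have y: "y \<ge> 1" using False by (simp add: y_def Suc_leI)
    have pos: "\<forall>p\<in>set ps. 1 \<le> p"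
      using assms(1) port_ge_1 by (fastforce simp: port_path_def awalk_def)
    have mem: "x \<in> set ps" unfolding x_def using False by simp
    with pos have x: "x \<ge> 1" by blast
    have lt: "y * 2 ^ y * x ^ y < K"
      using assms(2) by (simp add: path_type_def x_def y_def)
    have "y * 1 * 1 \<le> y * 2 ^ y * x ^ y"
      using x by (intro mult_le_mono) auto
    moreover have "1 * 1 * x ^ 1 \<le> y * 2 ^ y * x ^ y"
      using x y by (intro mult_le_mono power_increasing) auto
    ultimately have "y \<le> K" "x \<le> K" using lt unfolding power_one_right by linarith+
    moreover have "p \<le> x" if "p \<in> set ps" for p
      unfolding x_def using that by simp
    ultimately show ?thesis by (auto simp: y_def intro: order_trans)
  qed simp
  then show "set ps \<subseteq> {..K}" "length ps \<le> K" by auto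
qed

text \<open>Such a node is the unique end of one of finitely many bounded port sequences. The set
  demands a path because \<open>weight\<close> is unspecified without one.\<close>

lemma finite_small_weight:
  "finite {v. (\<exists>ps. port_path G port u ps v) \<and> weight G port u v < K}" (is "finite ?S")
proof (rule finite_subset)
  let ?L = "{ps. set ps \<subseteq> {..K} \<and> length ps \<le> K}"
  show "?S \<subseteq> (\<lambda>ps. THE v. port_path G port u ps v) ` ?L"
  proof
    fix v assume "v \<in> ?S"
    then obtain ps where path: "port_path G port u ps v"
      and small: "type_value (path_type ps) < K"
      by (auto elim: weight_attained)
    have "v = (THE v. port_path G port u ps v)"
      using path port_path_det by (metis the_equality)
    with port_path_bounds[OF path small] show "v \<in> (\<lambda>ps. THE v. port_path G port u ps v) ` ?L"
      by blast
  qed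
  show "finite ((\<lambda>ps. THE v. port_path G port u ps v) ` ?L)"
    by (intro finite_imageI finite_lists_length_le) simp
qed

lemma port_path_arc:
  "a \<in> arcs G \<Longrightarrow> port_path G port (tail G a) [port a] (head G a)"
  unfolding port_path_def by (rule exI[of _ "[a]"]) (simp add: awalk_def)

lemma tree_head_inj_on:
  assumes "undirected_tree G arev"
  shows "inj_on (head G) (out_arcs G b)"
proof (rule inj_onI, rule ccontr)
  fix a c assume ac: "a \<in> out_arcs G b" "c \<in> out_arcs G b" "head G a = head G c" "a \<noteq> c"
  have nocycle: "\<exists>a\<in>set p. arev a \<in> set p" if "cycle p" for p
    using assms that by (auto simp: undirected_tree_def)
  \<comment> \<open>Loops are excluded first: the two-arc closed walk below counts as a
    \<open>cycle\<close> only if \<open>b\<close> and \<open>head G a\<close> differ.\<close>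
  have noloop: "head G a \<noteq> b"
  proof
    assume "head G a = b"
    then have "cycle [a]"
      using ac by (auto simp: cycle_def awalk_def intro!: exI[of _ b])
    with nocycle[of "[a]"] show False using ac arev_neq[of a] by auto
  qed
  have "cycle [a, arev c]"
    using ac noloop by (auto simp: cycle_def awalk_def intro!: exI[of _ b])
  \<comment> \<open>An edge used in both directions would make \<open>a\<close> or \<open>c\<close>
    its own reverse, or give \<open>a = c\<close>.\<close>
  from nocycle[OF this] show False
    using ac arev_neq[of a] arev_neq[of c] arev_arev[of c] by (auto dest: arg_cong[of _ _ arev])
qed

end

theorem proposition2p1:
  fixes T :: "(nat, nat) pre_digraph" and arev :: "nat \<Rightarrow> nat" and port :: "nat \<Rightarrow> nat"
    and A :: algorithm and K :: nat
  assumes "port_graph T arev port"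
    and "undirected_tree T arev"
    and "\<And>v. v \<in> verts T \<Longrightarrow> node_degree T v = \<infinity>"
    and "universal A"
  shows "\<exists>b\<in>verts T. \<exists>t\<in>verts T.
           K \<le> weight T port b t \<and>
           real (hunt_time A T arev port b t) \<ge> real (weight T port b t) / 4"
proof -
  interpret port_graph T arev port by fact
  have conn: "connected T" using assms(2) by (simp add: undirected_tree_def)
  then obtain b where b: "b \<in> verts T"
    by (auto simp: connected_def strongly_connected_def)
  have found: "\<exists>n. at_node A T arev port b n t" if "t \<in> verts T" for t
    using assms(4) conn b that port_graph_axioms unfolding universal_def by blast
  define C where "C = {v. (\<exists>ps. port_path T port b ps v) \<and> weight T port b v < K}"
  define m where "m = 2 * card C + 2"
  define P where "P = {a \<in> out_arcs T b. port a \<le> m}"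
  \<comment> \<open>At infinite degree every positive integer is a port, so ports \<open>1\<close>
    to \<open>m\<close> exist however large \<open>m\<close> is.\<close>
  have bij: "bij_betw port (out_arcs T b) {p. 1 \<le> p}"
    using port_bij[OF b] assms(3)[OF b] by (simp add: ports_of_def)
  have "bij_betw port P {1..m}"
  proof (rule bij_betw_subset[OF bij])
    show "P \<subseteq> out_arcs T b" by (auto simp: P_def)
    have "port ` P = port ` out_arcs T b \<inter> {..m}" by (auto simp: P_def)
    also have "\<dots> = {1..m}" using bij by (auto simp: bij_betw_def)
    finally show "port ` P = {1..m}" .
  qed
  then have "card P = m" by (simp add: bij_betw_same_card)
  moreover have "inj_on (head T) P"
    using tree_head_inj_on[OF assms(2), of b] by (rule inj_on_subset) (auto simp: P_def)
  ultimately have "card (head T ` P) = m" by (simp add: card_image)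
  moreover have "finite C" unfolding C_def by (rule finite_small_weight)
  \<comment> \<open>At least \<open>m - card C = card C + 2\<close> neighbours remain, one more than
    the \<open>card C + 1\<close> times below \<open>card C + 1\<close>.\<close>
  ultimately have "card C + 1 < card (head T ` P - C)"
    using diff_card_le_card_Diff[of C "head T ` P"] by (simp add: m_def)
  moreover have "inj_on (hunt_time A T arev port b) (head T ` P - C)"
    by (rule hunt_time_inj_on) (use found in \<open>auto simp: P_def\<close>)
  ultimately obtain t where t: "t \<in> head T ` P - C" "card C + 1 \<le> hunt_time A T arev port b t"
    using inj_on_nat_large_value by blast
  then obtain a where a: "a \<in> arcs T" "tail T a = b" "head T a = t" "port a \<le> m"
    by (auto simp: P_def)
  have path: "port_path T port b [port a] t" using port_path_arc[OF a(1)] a by simp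
  \<comment> \<open>The one-edge path has type \<open>(port a, 1)\<close> and value
    \<open>2 * port a\<close>. The factor 4 arises from \<open>2 * m = 4 * (card C + 1)\<close>, at
    most four times the hunt time.\<close>
  have "weight T port b t \<le> 2 * m"
    using weight_le[OF path] a(4) by (simp add: path_type_def)
  moreover have "K \<le> weight T port b t"
    \<comment> \<open>As \<open>t\<close> is reachable by \<open>path\<close>, lying outside
      \<open>C\<close> can only mean large weight.\<close>
    using t(1) path by (auto simp: C_def not_less)
  moreover have "t \<in> verts T" using a by auto
  ultimately show ?thesis
    using b t(2) by (intro bexI[of _ b] bexI[of _ t]) (auto simp: m_def)
qed

end
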